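(* Let $G=(S,T;E)$ be a bipartite graph with $|S|=n$, $w:E\to\mathbb R_+$, $d\in\mathbb N$ and $b:S\cup T\to\mathbb Z_+\cup\{\infty\}$. Consider the following randomized algorithm (Algorithm 1): define $b'(v)=b(v)$ for $v\in S$ and $b'(t)=\min\{\lfloor n/d\rfloor,b(t)\}$ for $t\in T$; find a maximum-weight $b'$-matching $\widehat M$ of $G$; generate a cyclic permutation $s_1,\dots,s_n$ of $S$ uniformly at random; let $M$ consist of all edges $s_it\in\widehat M$ such that none of $s_{i-d+1}t,\dots,s_{i-1}t$ (indices modulo $n$) belongs to $\widehat M$; output $s_1,\dots,s_n$ and $M$. Then $M$ is a feasible cyclic $d$-distance $b$-matching under the output ordering whose expected weight is at least $\frac1e$ times the maximum, over all cyclic orderings of $S$, of the weight of a heaviest cyclic $d$-distance $b$-matching under that ordering. This lower bound is tight.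
   Context: For an ordering $s_1,\dots,s_n$ of $S$, an edge set $M\subseteq E$ is a cyclic $d$-distance $b$-matching if every $v\in S\cup T$ has degree at most $b(v)$ in $M$ and whenever $s_it,s_jt\in M$ with $i\ne j$, both $|i-j|\ge d$ and $|i-j|\le n-d$. A $b'$-matching is an edge set in which every node $v$ has degree at most $b'(v)$. $e$ is Euler's number.
   Formalization: The formal theorem assumes 1 ≤ d ≤ n: for d = 0 the quantity ⌊n/d⌋ is undefined, and for d > n the bound fails (one edge of weight 1, n = 1, d = 2: b'(t) = 0 gives expected weight 0 while the optimum is 1). *)

theory Defs
  imports "HOL-Probability.Probability" "HOL-Combinatorics.Multiset_Permutations"
    "HOL-Library.Extended_Nat"
begin

text \<open>An edge joining \<open>s \<in> S\<close> and \<open>t \<in> T\<close> is the pair \<open>(s, t)\<close>.\<close>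

definition bipartite_graph :: "'v set \<Rightarrow> 'v set \<Rightarrow> ('v \<times> 'v) set \<Rightarrow> bool" where
  "bipartite_graph S T E \<longleftrightarrow> finite S \<and> finite T \<and> S \<inter> T = {} \<and> E \<subseteq> S \<times> T"

definition degree_in :: "('v \<times> 'v) set \<Rightarrow> 'v \<Rightarrow> nat" where
  "degree_in M v = card {e \<in> M. fst e = v \<or> snd e = v}"

definition b_matching ::
  "'v set \<Rightarrow> 'v set \<Rightarrow> ('v \<times> 'v) set \<Rightarrow> ('v \<Rightarrow> enat) \<Rightarrow> ('v \<times> 'v) set \<Rightarrow> bool" where
  "b_matching S T E b M \<longleftrightarrow> M \<subseteq> E \<and> (\<forall>v \<in> S \<union> T. enat (degree_in M v) \<le> b v)"

text \<open>
  An ordering of \<open>S\<close> is a list \<open>xs \<in> permutations_of_set S\<close>; its positions are numbered from \<open>0\<close>,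
  which does not affect position differences.
\<close>

definition cyclic_distance_b_matching ::
  "'v set \<Rightarrow> 'v set \<Rightarrow> ('v \<times> 'v) set \<Rightarrow> nat \<Rightarrow> ('v \<Rightarrow> enat) \<Rightarrow> 'v list \<Rightarrow> ('v \<times> 'v) set \<Rightarrow> bool"
  where
  "cyclic_distance_b_matching S T E d b xs M \<longleftrightarrow>
     b_matching S T E b M \<and>
     (\<forall>i < length xs. \<forall>j < length xs. \<forall>t \<in> T.
        i \<noteq> j \<and> (xs ! i, t) \<in> M \<and> (xs ! j, t) \<in> M \<longrightarrow>
          int d \<le> \<bar>int i - int j\<bar> \<and> \<bar>int i - int j\<bar> \<le> int (length xs) - int d)"

definition weight :: "('v \<times> 'v \<Rightarrow> real) \<Rightarrow> ('v \<times> 'v) set \<Rightarrow> real" where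
  "weight w M = (\<Sum>e\<in>M. w e)"

definition heaviest_weight ::
  "'v set \<Rightarrow> 'v set \<Rightarrow> ('v \<times> 'v) set \<Rightarrow> ('v \<times> 'v \<Rightarrow> real) \<Rightarrow> nat \<Rightarrow> ('v \<Rightarrow> enat) \<Rightarrow> 'v list \<Rightarrow> real"
  where
  "heaviest_weight S T E w d b xs =
     Max (weight w ` {M. cyclic_distance_b_matching S T E d b xs M})"

definition opt_weight ::
  "'v set \<Rightarrow> 'v set \<Rightarrow> ('v \<times> 'v) set \<Rightarrow> ('v \<times> 'v \<Rightarrow> real) \<Rightarrow> nat \<Rightarrow> ('v \<Rightarrow> enat) \<Rightarrow> real"
  where
  "opt_weight S T E w d b = Max (heaviest_weight S T E w d b ` permutations_of_set S)"

definition max_weight_b_matching ::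
  "'v set \<Rightarrow> 'v set \<Rightarrow> ('v \<times> 'v) set \<Rightarrow> ('v \<times> 'v \<Rightarrow> real) \<Rightarrow> ('v \<Rightarrow> enat) \<Rightarrow> ('v \<times> 'v) set \<Rightarrow> bool"
  where
  "max_weight_b_matching S T E w b M \<longleftrightarrow>
     b_matching S T E b M \<and> (\<forall>N. b_matching S T E b N \<longrightarrow> weight w N \<le> weight w M)"

definition truncated_bound ::
  "'v set \<Rightarrow> 'v set \<Rightarrow> nat \<Rightarrow> ('v \<Rightarrow> enat) \<Rightarrow> 'v \<Rightarrow> enat" where
  "truncated_bound S T d b v = (if v \<in> T then min (enat (card S div d)) (b v) else b v)"

text \<open>
  For \<open>k < d \<le> n\<close> the index \<open>(i + n - k) mod n\<close> is \<open>i - k\<close> modulo \<open>n\<close>, without truncated subtraction.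
\<close>

definition selected_edges :: "nat \<Rightarrow> ('v \<times> 'v) set \<Rightarrow> 'v list \<Rightarrow> ('v \<times> 'v) set" where
  "selected_edges d Mhat xs =
     (let n = length xs in
      {(xs ! i, t) | i t. i < n \<and> (xs ! i, t) \<in> Mhat \<and>
         (\<forall>k \<in> {1..<d}. (xs ! ((i + n - k) mod n), t) \<notin> Mhat)})"

text \<open>
  The output distribution of the algorithm, given the maximum-weight matching \<open>Mhat\<close> for the
  truncated bounds that it found. A uniformly random cyclic order is drawn as a uniformly random
  list: each cyclic order is represented by the same number of lists, namely its rotations.
\<close>

definition algorithm_output ::
  "'v set \<Rightarrow> nat \<Rightarrow> ('v \<times> 'v) set \<Rightarrow> ('v list \<times> ('v \<times> 'v) set) pmf" where
  "algorithm_output S d Mhat =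
     map_pmf (\<lambda>xs. (xs, selected_edges d Mhat xs)) (pmf_of_set (permutations_of_set S))"

definition valid_instance ::
  "'v set \<Rightarrow> 'v set \<Rightarrow> ('v \<times> 'v) set \<Rightarrow> ('v \<times> 'v \<Rightarrow> real) \<Rightarrow> nat \<Rightarrow> bool" where
  "valid_instance S T E w d \<longleftrightarrow>
     bipartite_graph S T E \<and> (\<forall>e\<in>E. 0 \<le> w e) \<and> 1 \<le> d \<and> d \<le> card S"

end

theory Submission
  imports Defs
begin

text \<open>
  If \<open>t\<close> has degree \<open>k\<close> in the optimal \<open>b'\<close>-matching, an edge at \<open>t\<close> survives with probability
  \<open>C(n - d, k - 1) / C(n - 1, k - 1)\<close>, a product of \<open>k - 1\<close> factors each at least \<open>1 - 1/k\<close> because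
  \<open>k d \<le> n\<close>; hence it is at least \<open>(1 - 1/k)^(k - 1) \<ge> 1/e\<close>. Every cyclic \<open>d\<close>-distance
  \<open>b\<close>-matching is a \<open>b'\<close>-matching, so the optimum is at most the weight of the \<open>b'\<close>-matching.
  For tightness take a complete star with \<open>n = m\<^sup>2\<close> leaves and \<open>d = m\<close>: the optimum is at least \<open>m\<close>, while
  edges survive with probability at most \<open>exp (- ((m - 1) / m)\<^sup>2)\<close>, which tends to \<open>1/e\<close>.
\<close>

section \<open>Edge survival as an event about orderings, and its symmetry\<close>

definition isolated :: "nat \<Rightarrow> 'v list \<Rightarrow> 'v \<Rightarrow> 'v set \<Rightarrow> bool" where
  "isolated d xs s N \<longleftrightarrow>
     (\<exists>i < length xs. xs ! i = s \<and>
        (\<forall>k \<in> {1..<d}. xs ! ((i + length xs - k) mod length xs) \<notin> N))"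

text \<open>Separating out \<open>t\<close> shows that survival of an edge depends only on the
  ordering, on \<open>s\<close> and on the neighbourhood of \<open>t\<close> in \<open>Mhat\<close>;
  this makes relabelling the elements of \<open>S\<close> possible.\<close>

lemma selected_edges_iff:
  "(s, t) \<in> selected_edges d Mhat xs \<longleftrightarrow>
     (s, t) \<in> Mhat \<and> isolated d xs s {s. (s, t) \<in> Mhat}"
  by (auto simp: selected_edges_def isolated_def Let_def)

lemma selected_edges_subset: "selected_edges d Mhat xs \<subseteq> Mhat"
  by (auto simp: selected_edges_def Let_def)

text \<open>Isolation only tests entries for equality with \<open>s\<close> and for membership in
  \<open>N\<close>. A relabelling that is injective on \<open>S\<close> preserves both tests, and
  positions do not change.\<close>

lemma isolated_map:
  assumes "inj_on f S" "set xs \<subseteq> S" "s \<in> S" "N \<subseteq> S"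
  shows "isolated d (map f xs) (f s) (f ` N) \<longleftrightarrow> isolated d xs s N"
proof -
  have mem: "xs ! j \<in> S" if "j < length xs" for j
    using assms(2) that by (meson nth_mem subsetD)
  have *: "f (xs ! j) \<in> f ` N \<longleftrightarrow> xs ! j \<in> N" if "j < length xs" for j
    using inj_on_image_mem_iff[OF assms(1) mem[OF that] assms(4)] .
  have **: "f (xs ! j) = f s \<longleftrightarrow> xs ! j = s" if "j < length xs" for j
    using inj_on_eq_iff[OF assms(1) mem[OF that] assms(3)] .
  have ***: "a mod length xs < length xs" if "i < length xs" for a i
    using that by (intro mod_less_divisor) auto
  show ?thesis
    unfolding isolated_def length_map
    by (intro ex_cong1 conj_cong refl ball_cong) (simp_all add: * ** ***)
qed

text \<open>A permutation of \<open>S\<close> that fixes \<open>s\<close> and carries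
  \<open>N\<close> onto \<open>N'\<close> acts bijectively on the orderings and carries those
  isolating \<open>s\<close> from \<open>N\<close> onto those isolating it from
  \<open>N'\<close>.\<close>

lemma card_isolated_eq:
  assumes S: "finite S" and s: "s \<in> N" "s \<in> N'" and N: "N \<subseteq> S" "N' \<subseteq> S" "card N = card N'"
  shows "card {xs \<in> permutations_of_set S. isolated d xs s N} =
         card {xs \<in> permutations_of_set S. isolated d xs s N'}"
proof -
  have fin: "finite N" "finite N'"
    using S N finite_subset by auto
  obtain f where f: "bij_betw f (N - {s}) (N' - {s})"
    using finite_same_card_bij[of "N - {s}" "N' - {s}"] fin s N(3) by auto
  have "card (S - N) = card (S - N')"
    using N fin by (simp add: card_Diff_subset)
  then obtain g where g: "bij_betw g (S - N) (S - N')"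
    using finite_same_card_bij[of "S - N" "S - N'"] S by auto
  \<comment> \<open>The permutation is glued from bijections on \<open>{s}\<close>,
    \<open>N - {s}\<close> and \<open>S - N\<close>; the last one exists because the complements of
    \<open>N\<close> and \<open>N'\<close> in \<open>S\<close> also have equal size.\<close>
  define h where "h = (\<lambda>x. if x = s then s else if x \<in> N then f x else g x)"
  have h1: "bij_betw h (N - {s}) (N' - {s})"
    using f by (rule bij_betw_cong[THEN iffD1, rotated]) (auto simp: h_def)
  have h2: "bij_betw h (S - N) (S - N')"
    using g s(1) by (intro bij_betw_cong[THEN iffD1, OF _ g]) (auto simp: h_def)
  have h3: "bij_betw h {s} {s}"
    by (auto simp: h_def bij_betw_def)
  have hN: "bij_betw h N N'"
    using bij_betw_combine[OF h3 h1] s by (simp add: insert_absorb)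
  have hS: "bij_betw h S S"
    using bij_betw_combine[OF hN h2] N by (simp add: Un_absorb1)
  have inj: "inj_on h S" and img: "h ` S = S" "h ` N = N'" "h s = s"
    using hS hN by (auto simp: bij_betw_def h_def)
  have perm: "permutations_of_set S = map h ` permutations_of_set S"
    using permutations_of_set_image_inj[OF inj] img by simp
  have eq: "isolated d (map h xs) s N' \<longleftrightarrow> isolated d xs s N" if "xs \<in> permutations_of_set S" for xs
    using isolated_map[OF inj, of xs s N d] that s N img by (auto simp: permutations_of_set_def)
  have "{xs \<in> permutations_of_set S. isolated d xs s N'} =
        map h ` {xs \<in> permutations_of_set S. isolated d xs s N}"
    using eq by (subst perm) auto
  moreover have "inj_on (map h) {xs \<in> permutations_of_set S. isolated d xs s N}"
    by (rule inj_on_subset[OF inj_on_mapI[of h "permutations_of_set S"]])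
       (auto simp: permutations_of_set_def intro!: inj_on_subset[OF inj])
  ultimately show ?thesis
    by (simp add: card_image)
qed

text \<open>\<open>D\<close> consists of the \<open>d - 1\<close> cyclic predecessors of
  \<open>s\<close>. They are distinct and differ from \<open>s\<close> because \<open>d\<close> is
  at most \<open>card S\<close>, so looking back never completes a full turn.\<close>

lemma isolated_eq_disjoint:
  assumes "xs \<in> permutations_of_set S" "s \<in> S" "finite S" "d \<le> card S" "1 \<le> d"
  obtains D where "D \<subseteq> S - {s}" "card D = d - 1" "\<And>N. isolated d xs s N \<longleftrightarrow> D \<inter> N = {}"
proof -
  let ?n = "card S"
  have xs: "set xs = S" "distinct xs" "length xs = ?n"
    using assms by (auto simp: permutations_of_set_def distinct_card)
  obtain i where i: "i < ?n" "xs ! i = s"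
    using assms(2) xs by (metis in_set_conv_nth)
  define p where "p = (\<lambda>k. (i + ?n - k) mod ?n)"
  have p_less: "p k < ?n" for k
    using i by (auto simp: p_def)
  have p_eq: "p k = (if k \<le> i then i - k else i + ?n - k)" if "k < d" for k
  proof (cases "k \<le> i")
    case True
    then have "i + ?n - k = i - k + ?n" by simp
    then show ?thesis using True i by (simp only: p_def mod_add_self2) simp
  next
    case False
    then show ?thesis using that assms i by (simp add: p_def)
  qed
  \<comment> \<open>Indices without wraparound are at most \<open>i\<close>; those with wraparound
    exceed \<open>i\<close>, since \<open>k < d\<close> and \<open>d\<close> is at most the length.
    The value \<open>k = 0\<close> is included so that injectivity also separates the predecessors
    from \<open>s\<close> itself.\<close>
  have inj_p: "inj_on p {..<d}"
    using assms i by (intro inj_onI) (auto simp: p_eq split: if_splits)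
  have inj: "inj_on (\<lambda>k. xs ! p k) {..<d}"
    using inj_p p_less xs by (auto simp: inj_on_def nth_eq_iff_index_eq)
  define D where "D = (\<lambda>k. xs ! p k) ` {1..<d}"
  have "p 0 = i" using i by (simp add: p_def)
  then have ne: "xs ! p k \<noteq> s" if "k \<in> {1..<d}" for k
    using inj_onD[OF inj, of k 0] that i by auto
  have "D \<subseteq> S - {s}"
    unfolding D_def
  proof (rule image_subsetI)
    fix k assume "k \<in> {1..<d}"
    then show "xs ! p k \<in> S - {s}"
      using ne[of k] nth_mem[of "p k" xs] p_less[of k] xs by simp
  qed
  moreover have "card D = d - 1"
    unfolding D_def by (subst card_image) (auto intro: inj_on_subset[OF inj])
  moreover have "isolated d xs s N \<longleftrightarrow> D \<inter> N = {}" for N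
  proof -
    have "j = i" if "j < ?n" "xs ! j = s" for j
      using that i xs by (metis nth_eq_iff_index_eq)
    then have "isolated d xs s N \<longleftrightarrow> (\<forall>k \<in> {1..<d}. xs ! p k \<notin> N)"
      unfolding isolated_def xs p_def using i by blast
    then show ?thesis by (auto simp: D_def)
  qed
  ultimately show ?thesis using that by blast
qed

lemma card_subsets_containing:
  assumes "finite A" "s \<in> A" "1 \<le> k"
  shows "card {N. s \<in> N \<and> N \<subseteq> A \<and> card N = k} = (card A - 1) choose (k - 1)"
proof -
  have "bij_betw (insert s) {N. N \<subseteq> A - {s} \<and> card N = k - 1} {N. s \<in> N \<and> N \<subseteq> A \<and> card N = k}"
  proof (rule bij_betw_byWitness[where f' = "\<lambda>N. N - {s}"])
    show "insert s ` {N. N \<subseteq> A - {s} \<and> card N = k - 1} \<subseteq> {N. s \<in> N \<and> N \<subseteq> A \<and> card N = k}"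
    proof safe
      fix N assume N: "N \<subseteq> A - {s}" "card N = k - 1"
      then have "finite N" "s \<notin> N" using assms finite_subset by auto
      then show "card (insert s N) = k" using N assms by simp
    qed (use assms in auto)
  qed (use assms in auto)
  then have "card {N. s \<in> N \<and> N \<subseteq> A \<and> card N = k} = card {N. N \<subseteq> A - {s} \<and> card N = k - 1}"
    by (rule bij_betw_same_card[symmetric])
  then show ?thesis
    using n_subsets[of "A - {s}" "k - 1"] assms by simp
qed

text \<open>
  Double counting: by symmetry the number of orderings isolating \<open>s\<close> is the same for all \<open>N\<close> of the
  same size, while for a fixed ordering the sets \<open>N\<close> are those avoiding \<open>d - 1\<close> given elements.
\<close>

lemma card_isolated:
  assumes S: "finite S" "d \<le> card S" "1 \<le> d" and N: "s \<in> N" "N \<subseteq> S"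
  shows "card {xs \<in> permutations_of_set S. isolated d xs s N} * ((card S - 1) choose (card N - 1)) =
         fact (card S) * ((card S - d) choose (card N - 1))"
proof -
  let ?P = "permutations_of_set S" and ?k = "card N"
  let ?F = "{N'. s \<in> N' \<and> N' \<subseteq> S \<and> card N' = ?k}"
  have fin: "finite ?F"
    by (rule finite_subset[of _ "Pow S"]) (use S in auto)
  have s: "s \<in> S" and k: "1 \<le> ?k"
    using N S by (auto simp: Suc_le_eq card_gt_0_iff intro: finite_subset)
  have "card {xs \<in> ?P. isolated d xs s N} * card ?F =
        (\<Sum>N'\<in>?F. card {xs \<in> ?P. isolated d xs s N'})"
  proof -
    have "(\<Sum>N'\<in>?F. card {xs \<in> ?P. isolated d xs s N'}) =
          (\<Sum>N'\<in>?F. card {xs \<in> ?P. isolated d xs s N})"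
      using S N by (intro sum.cong refl card_isolated_eq) auto
    then show ?thesis by simp
  qed
  also have "\<dots> = (\<Sum>N'\<in>?F. \<Sum>xs\<in>?P. if isolated d xs s N' then 1 else 0)"
    by (simp add: sum.If_cases Int_def)
  also have "\<dots> = (\<Sum>xs\<in>?P. \<Sum>N'\<in>?F. if isolated d xs s N' then 1 else 0)"
    by (rule sum.swap)
  also have "\<dots> = (\<Sum>xs\<in>?P. (card S - d) choose (?k - 1))"
  proof (rule sum.cong[OF refl])
    fix xs assume xs: "xs \<in> ?P"
    obtain D where D: "D \<subseteq> S - {s}" "card D = d - 1" "\<And>N. isolated d xs s N \<longleftrightarrow> D \<inter> N = {}"
      using isolated_eq_disjoint[OF xs s S(1) S(2) S(3)] by blast
    have finD: "finite D" using D S finite_subset by blast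
    have "(\<Sum>N'\<in>?F. if isolated d xs s N' then 1 else 0) = card {N' \<in> ?F. D \<inter> N' = {}}"
      using fin by (simp add: sum.If_cases Int_def D)
    also have "{N' \<in> ?F. D \<inter> N' = {}} = {N'. s \<in> N' \<and> N' \<subseteq> S - D \<and> card N' = ?k}"
      by auto
    \<comment> \<open>Since \<open>s\<close> is not in \<open>D\<close>, such an \<open>N'\<close>
      is \<open>s\<close> together with \<open>card N - 1\<close> of the other elements of
      \<open>S - D\<close>, of which there are \<open>card S - d\<close>.\<close>
    also have "card \<dots> = (card (S - D) - 1) choose (?k - 1)"
      using S s D k by (intro card_subsets_containing) auto
    also have "card (S - D) = card S - (d - 1)"
      using D finD by (subst card_Diff_subset) auto
    finally show "(\<Sum>N'\<in>?F. if isolated d xs s N' then 1 else 0) = (card S - d) choose (?k - 1)"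
      using S by simp
  qed
  also have "\<dots> = fact (card S) * ((card S - d) choose (?k - 1))"
    using S by simp
  finally show ?thesis
    using card_subsets_containing[OF S(1) s k] by simp
qed

section \<open>The survival probability and its bounds\<close>

text \<open>Here \<open>k\<close> is the size of the neighbourhood including \<open>s\<close>. Its
  other \<open>k - 1\<close> members form a random subset of the \<open>n - 1\<close> remaining
  positions, and the \<open>d - 1\<close> positions preceding \<open>s\<close> must be
  missed.\<close>

definition isolation_prob :: "nat \<Rightarrow> nat \<Rightarrow> nat \<Rightarrow> real" where
  "isolation_prob n d k = real ((n - d) choose (k - 1)) / real ((n - 1) choose (k - 1))"

text \<open>Both binomials are falling factorials over the same \<open>(k - 1)!\<close>, which
  cancels. If \<open>k - 1 > n - d\<close>, both sides are zero, since the factor with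
  \<open>i = n - d\<close> vanishes.\<close>

lemma isolation_prob_eq_prod:
  assumes "1 \<le> d" "d \<le> n" "1 \<le> k" "k \<le> n"
  shows "isolation_prob n d k = (\<Prod>i<k - 1. (real n - real d - real i) / (real n - 1 - real i))"
  using assms
  by (simp add: isolation_prob_def binomial_gbinomial gbinomial_prod_rev prod_dividef
      of_nat_diff lessThan_atLeast0)

lemma isolation_prob_ge:
  assumes "1 \<le> d" "1 \<le> k" "k * d \<le> n"
  shows "1 / exp 1 \<le> isolation_prob n d k"
proof -
  have n: "d \<le> n" "k \<le> n"
    using assms by (metis dual_order.trans mult_le_mono1 mult_le_mono2 mult_1 mult.right_neutral)+
  have kd: "real k * real d \<le> real n"
    using assms by (metis of_nat_le_iff of_nat_mult)
  have factor: "(real k - 1) / real k \<le> (real n - real d - real i) / (real n - 1 - real i)" if "i < k - 1" for i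
  proof -
    have i: "real i + 1 < real k" using that by linarith
    have "real k \<le> real n" using n by simp
    then have pos: "real n - 1 - i > 0" using i by linarith
    \<comment> \<open>Right side minus left side equals \<open>(n - k * d) + (k - 1 - i)\<close>, a
      sum of nonnegative terms.\<close>
    have "(real k - 1) * (real n - 1 - i) \<le> (real n - d - i) * real k"
      using kd i by (simp add: algebra_simps)
    then show ?thesis
      using pos assms by (simp add: divide_simps)
  qed
  \<comment> \<open>With \<open>m = k - 1\<close> the base is the reciprocal of
    \<open>1 + 1 / m\<close>, whose \<open>m\<close>-th power is at most e. The case
    \<open>k = 1\<close> is split off because then \<open>m = 0\<close>; the power is the empty
    product 1.\<close>
  have "1 / exp 1 \<le> ((real k - 1) / real k) ^ (k - 1)"
  proof (cases "k = 1")
    case False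
    define m where "m = k - 1"
    have m: "m > 0" "real k = real m + 1"
      using False assms by (auto simp: m_def)
    have "(1 + 1 / real m) ^ m \<le> exp (1 / real m) ^ m"
      by (intro power_mono exp_ge_add_one_self) auto
    also have "\<dots> = exp 1"
      using m by (simp flip: exp_of_nat_mult)
    finally have "1 / exp 1 \<le> 1 / (1 + 1 / real m) ^ m"
      by (intro divide_left_mono mult_pos_pos zero_less_power add_pos_pos) (use m in auto)
    also have "\<dots> = (1 / (1 + 1 / real m)) ^ m"
      by (simp add: power_one_over)
    also have "1 / (1 + 1 / real m) = (real k - 1) / real k"
      using m by (simp add: field_simps)
    finally show ?thesis by (simp add: m_def)
  qed auto
  also have "\<dots> = (\<Prod>i<k - 1. (real k - 1) / real k)"
    by simp
  also have "\<dots> \<le> (\<Prod>i<k - 1. (real n - real d - real i) / (real n - 1 - real i))"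
    using assms factor by (intro prod_mono) auto
  also have "\<dots> = isolation_prob n d k"
    using isolation_prob_eq_prod n assms by simp
  finally show ?thesis .
qed

text \<open>Serves tightness. Each factor is \<open>1 - (d - 1) / (n - 1 - i)\<close>, hence at most
  \<open>1 - (d - 1) / n\<close>, and \<open>1 + x\<close> is at most \<open>exp x\<close>. The
  bound on \<open>k + d\<close> keeps the factors nonnegative, as a comparison of products
  requires.\<close>

lemma isolation_prob_le:
  assumes "1 \<le> d" "1 \<le> k" "k + d \<le> n + 1"
  shows "isolation_prob n d k \<le> exp (- ((real k - 1) * (real d - 1) / real n))"
proof -
  have n: "d \<le> n" "k \<le> n" using assms by auto
  have "isolation_prob n d k = (\<Prod>i<k - 1. (real n - real d - real i) / (real n - 1 - real i))"
    using isolation_prob_eq_prod n assms by simp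
  also have "\<dots> \<le> (\<Prod>i<k - 1. exp (- ((real d - 1) / real n)))"
  proof (intro prod_mono conjI)
    fix i assume "i \<in> {..<k - 1}"
    then have i: "real i + 1 < real k" "real k + real d \<le> real n + 1" "real d \<ge> 1"
      using assms by auto
    then have pos: "real n - 1 - i > 0" "real n > 0" by linarith+
    show "0 \<le> (real n - real d - real i) / (real n - 1 - real i)"
      using i pos by simp
    have "(real n - real d - real i) / (real n - 1 - real i) = 1 - (real d - 1) / (real n - 1 - i)"
      using pos by (simp add: field_simps)
    also have "\<dots> \<le> 1 + - ((real d - 1) / real n)"
      using i pos by (auto intro!: divide_left_mono)
    also have "\<dots> \<le> exp (- ((real d - 1) / real n))"
      by (rule exp_ge_add_one_self)
    finally show "(real n - real d - real i) / (real n - 1 - real i) \<le> exp (- ((real d - 1) / real n))" .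
  qed
  also have "\<dots> = exp (- ((real k - 1) * (real d - 1) / real n))"
    using assms by (simp add: of_nat_diff flip: exp_of_nat_mult)
  finally show ?thesis .
qed

section \<open>Expected weight of the output\<close>

lemma degree_in_right:
  assumes "bipartite_graph S T E" "M \<subseteq> E" "t \<in> T"
  shows "degree_in M t = card {s. (s, t) \<in> M}"
proof -
  \<comment> \<open>A node of \<open>T\<close> is never a first component, because \<open>S\<close>
    and \<open>T\<close> are disjoint.\<close>
  have "{e \<in> M. fst e = t \<or> snd e = t} = (\<lambda>s. (s, t)) ` {s. (s, t) \<in> M}"
    using assms by (fastforce simp: bipartite_graph_def)
  then show ?thesis
    by (simp add: degree_in_def card_image inj_on_def)
qed

text \<open>Linearity of expectation: the sums over orderings and over edges are exchanged, and the
  orderings in which a given edge survives are counted by \<open>card_isolated\<close>.\<close>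

lemma expectation_algorithm_output:
  assumes "bipartite_graph S T E" "1 \<le> d" "d \<le> card S" "Mhat \<subseteq> E"
  shows "measure_pmf.expectation (algorithm_output S d Mhat) (\<lambda>(xs, M). weight w M) =
           (\<Sum>(s, t)\<in>Mhat. w (s, t) * isolation_prob (card S) d (degree_in Mhat t))"
proof -
  let ?P = "permutations_of_set S"
  have fin: "finite S" "finite T" and sub: "Mhat \<subseteq> S \<times> T"
    using assms by (auto simp: bipartite_graph_def)
  have fin_Mhat: "finite Mhat"
    by (rule finite_subset[OF sub]) (use fin in simp)
  have "measure_pmf.expectation (algorithm_output S d Mhat) (\<lambda>(xs, M). weight w M) =
          (\<Sum>xs\<in>?P. weight w (selected_edges d Mhat xs)) / fact (card S)"
    using fin by (simp add: algorithm_output_def integral_pmf_of_set)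
  also have "(\<Sum>xs\<in>?P. weight w (selected_edges d Mhat xs)) =
      (\<Sum>xs\<in>?P. \<Sum>e\<in>Mhat. if e \<in> selected_edges d Mhat xs then w e else 0)"
    unfolding weight_def
  proof (rule sum.cong[OF refl])
    fix xs
    show "(\<Sum>e\<in>selected_edges d Mhat xs. w e) =
        (\<Sum>e\<in>Mhat. if e \<in> selected_edges d Mhat xs then w e else 0)"
      using fin_Mhat selected_edges_subset by (intro sum.mono_neutral_cong_left) auto
  qed
  also have "\<dots> = (\<Sum>e\<in>Mhat. \<Sum>xs\<in>?P. if e \<in> selected_edges d Mhat xs then w e else 0)"
    by (rule sum.swap)
  also have "\<dots> / fact (card S) =
      (\<Sum>e\<in>Mhat. (\<Sum>xs\<in>?P. if e \<in> selected_edges d Mhat xs then w e else 0) / fact (card S))"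
    by (rule sum_divide_distrib)
  also have "\<dots> = (\<Sum>(s, t)\<in>Mhat. w (s, t) * isolation_prob (card S) d (degree_in Mhat t))"
  proof (rule sum.cong[OF refl], clarify)
    fix s t assume st: "(s, t) \<in> Mhat"
    let ?N = "{s. (s, t) \<in> Mhat}"
    have N: "s \<in> ?N" "?N \<subseteq> S" and t: "t \<in> T" using st sub by auto
    have deg: "degree_in Mhat t = card ?N"
      using degree_in_right[OF assms(1,4) t] .
    have "card ?N \<le> card S" using N fin by (intro card_mono)
    then have pos: "(card S - 1) choose (card ?N - 1) > 0"
      by (intro zero_less_binomial) simp
    have "real (card {xs \<in> ?P. isolated d xs s ?N}) * real ((card S - 1) choose (card ?N - 1)) =
        fact (card S) * real ((card S - d) choose (card ?N - 1))"
      using arg_cong[OF card_isolated[OF fin(1) assms(3,2) N], of real] by simp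
    then have "real (card {xs \<in> ?P. isolated d xs s ?N}) / fact (card S) =
        isolation_prob (card S) d (card ?N)"
      using pos by (simp add: isolation_prob_def field_simps)
    moreover have "(\<Sum>xs\<in>?P. if (s, t) \<in> selected_edges d Mhat xs then w (s, t) else 0) =
        w (s, t) * real (card {xs \<in> ?P. isolated d xs s ?N})"
      using st by (simp add: selected_edges_iff sum.If_cases Int_def)
    ultimately show "(\<Sum>xs\<in>?P. if (s, t) \<in> selected_edges d Mhat xs then w (s, t) else 0) / fact (card S)
        = w (s, t) * isolation_prob (card S) d (degree_in Mhat t)"
      by (simp add: deg flip: times_divide_eq_right)
  qed
  finally show ?thesis .
qed

section \<open>Feasibility of the output\<close>

lemma degree_in_mono: "finite M \<Longrightarrow> N \<subseteq> M \<Longrightarrow> degree_in N v \<le> degree_in M v"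
  unfolding degree_in_def by (rule card_mono) auto

lemma b_matching_mono:
  assumes "b_matching S T E b M" "finite E" "N \<subseteq> M"
    and "\<And>v. v \<in> S \<union> T \<Longrightarrow> b v \<le> b' v"
  shows "b_matching S T E b' N"
proof -
  have M: "finite M" "M \<subseteq> E"
    using assms finite_subset by (auto simp: b_matching_def)
  have "enat (degree_in N v) \<le> b' v" if "v \<in> S \<union> T" for v
  proof -
    have "enat (degree_in N v) \<le> enat (degree_in M v)"
      using degree_in_mono[OF M(1) assms(3)] by simp
    also have "\<dots> \<le> b v" using assms(1) that by (auto simp: b_matching_def)
    also have "\<dots> \<le> b' v" using assms(4) that by blast
    finally show ?thesis .
  qed
  then show ?thesis using M assms(3) by (auto simp: b_matching_def)
qed

text \<open>Degrees only shrink when passing from \<open>Mhat\<close> to the selected edges. For two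
  selected edges at \<open>t\<close> in positions \<open>j < i\<close>, position \<open>j\<close>
  lies \<open>i - j\<close> steps before \<open>i\<close>, and \<open>i\<close> lies
  \<open>n - (i - j)\<close> steps cyclically before \<open>j\<close>. Selection of either edge
  forbids fewer than \<open>d\<close> steps back to the other.\<close>

lemma selected_edges_feasible:
  assumes "bipartite_graph S T E" "d \<le> card S"
    and "b_matching S T E (truncated_bound S T d b) Mhat" "xs \<in> permutations_of_set S"
  shows "cyclic_distance_b_matching S T E d b xs (selected_edges d Mhat xs)"
proof -
  let ?M = "selected_edges d Mhat xs" and ?n = "length xs"
  have "finite E"
    using assms finite_subset by (auto simp: bipartite_graph_def)
  then have bm: "b_matching S T E b ?M"
    by (rule b_matching_mono[OF assms(3) _ selected_edges_subset]) (auto simp: truncated_bound_def)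
  have n: "?n = card S" and dist: "distinct xs"
    using assms(4) by (auto simp: permutations_of_set_def distinct_card)
  have no: "(xs ! ((i + ?n - k) mod ?n), t) \<notin> Mhat"
    if sel: "(xs ! i, t) \<in> ?M" "i < ?n" "1 \<le> k" "k < d" for i k t
  proof -
    obtain j where j: "j < ?n" "xs ! j = xs ! i"
      "\<forall>k \<in> {1..<d}. (xs ! ((j + ?n - k) mod ?n), t) \<notin> Mhat"
      using sel unfolding selected_edges_iff isolated_def by auto
    then have "j = i" using dist that by (simp add: nth_eq_iff_index_eq)
    then show ?thesis using j that by auto
  qed
  have *: "d \<le> i - j \<and> i - j \<le> ?n - d"
    if "j < i" "i < ?n" "(xs ! i, t) \<in> ?M" "(xs ! j, t) \<in> ?M" for i j t
  proof -
    have Mh: "(xs ! i, t) \<in> Mhat" "(xs ! j, t) \<in> Mhat"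
      using that selected_edges_subset[of d Mhat xs] by auto
    have "d \<le> i - j"
    proof (rule ccontr)
      assume "\<not> d \<le> i - j"
      then have "(xs ! ((i + ?n - (i - j)) mod ?n), t) \<notin> Mhat"
        using that by (intro no) auto
      moreover have "i + ?n - (i - j) = j + ?n" using that by simp
      ultimately show False using Mh that by simp
    qed
    moreover have "i - j \<le> ?n - d"
    proof (rule ccontr)
      assume "\<not> i - j \<le> ?n - d"
      then have "(xs ! ((j + ?n - (?n - (i - j))) mod ?n), t) \<notin> Mhat"
        using that by (intro no) auto
      moreover have "j + ?n - (?n - (i - j)) = i" using that by simp
      ultimately show False using Mh that by simp
    qed
    ultimately show ?thesis by simp
  qed
  have "int d \<le> \<bar>int i - int j\<bar> \<and> \<bar>int i - int j\<bar> \<le> int ?n - int d"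
    if "i < ?n" "j < ?n" "i \<noteq> j" "(xs ! i, t) \<in> ?M" "(xs ! j, t) \<in> ?M" for i j t
    using *[of j i t] *[of i j t] that n assms(2) by (cases "j < i") auto
  then show ?thesis
    using bm unfolding cyclic_distance_b_matching_def by blast
qed

section \<open>Bounding the optimum by truncated matchings\<close>

text \<open>The cyclic intervals of length \<open>d\<close> starting at the positions in \<open>P\<close> are disjoint.\<close>

lemma card_separated_positions:
  assumes P: "P \<subseteq> {..<n}" and d: "d \<le> n"
    and sep: "\<And>i j. i \<in> P \<Longrightarrow> j \<in> P \<Longrightarrow> i \<noteq> j \<Longrightarrow>
      int d \<le> \<bar>int i - int j\<bar> \<and> \<bar>int i - int j\<bar> \<le> int n - int d"
  shows "card P * d \<le> n"
proof -
  have "inj_on (\<lambda>(p, r). (p + r) mod n) (P \<times> {..<d})"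
  proof (rule inj_onI)
    fix x y
    assume "x \<in> P \<times> {..<d}" "y \<in> P \<times> {..<d}"
      and eq: "(case x of (p, r) \<Rightarrow> (p + r) mod n) = (case y of (p, r) \<Rightarrow> (p + r) mod n)"
    then obtain p r q r' where xy: "x = (p, r)" "y = (q, r')"
      and *: "p \<in> P" "q \<in> P" "r < d" "r' < d"
      by auto
    have dv: "int n dvd (int p + int r) - (int q + int r')"
      using eq unfolding xy prod.case by (metis mod_eq_dvd_iff of_nat_add of_nat_mod)
    have small: "(int p + int r) - (int q + int r') = 0"
      if "\<bar>(int p + int r) - (int q + int r')\<bar> < int n"
      using dvd_imp_le_int[OF _ dv] that by linarith
    have "p = q"
    proof (rule ccontr)
      assume "p \<noteq> q"
      \<comment> \<open>As \<open>r\<close> and \<open>r'\<close> differ by less than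
        \<open>d\<close>, the upper bound \<open>n - d\<close> makes the total difference smaller
        than \<open>n\<close>, hence zero. Then \<open>p\<close> and \<open>q\<close> differ by as
        much as \<open>r\<close> and \<open>r'\<close>, against the lower bound
        \<open>d\<close>.\<close>
      note s = sep[OF *(1,2) this]
      have "(int p + int r) - (int q + int r') = 0"
        using s * by (intro small) auto
      then show False using s * by auto
    qed
    moreover from this have "r = r'"
      using small * d by auto
    ultimately show "x = y" by (simp add: xy)
  qed
  then have "card (P \<times> {..<d}) \<le> card {..<n}"
    using P by (intro card_inj_on_le[where f = "\<lambda>(p, r). (p + r) mod n"]) (auto intro!: mod_less_divisor)
  then show ?thesis by (simp add: card_cartesian_product)
qed

text \<open>The neighbours of \<open>t\<close> occupy cyclically separated positions of the
  ordering, so packing intervals of length \<open>d\<close> leaves room for at most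
  \<open>n div d\<close> of them.\<close>

lemma cyclic_distance_imp_truncated:
  assumes "bipartite_graph S T E" "1 \<le> d" "d \<le> card S" "xs \<in> permutations_of_set S"
    and M: "cyclic_distance_b_matching S T E d b xs M"
  shows "b_matching S T E (truncated_bound S T d b) M"
proof -
  have xs: "set xs = S" "distinct xs" "length xs = card S"
    using assms by (auto simp: permutations_of_set_def distinct_card)
  have bm: "b_matching S T E b M" and ME: "M \<subseteq> E"
    using M by (auto simp: cyclic_distance_b_matching_def b_matching_def)
  have "degree_in M t \<le> card S div d" if t: "t \<in> T" for t
  proof -
    let ?P = "{i. i < length xs \<and> (xs ! i, t) \<in> M}"
    have "s \<in> (!) xs ` ?P" if "(s, t) \<in> M" for s
    proof -
      have "s \<in> set xs" using that assms(1) ME xs(1) by (auto simp: bipartite_graph_def)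
      then obtain i where "i < length xs" "xs ! i = s" by (meson in_set_conv_nth)
      with that show ?thesis by blast
    qed
    then have "{s. (s, t) \<in> M} = (!) xs ` ?P"
      by auto
    moreover have "inj_on ((!) xs) ?P"
      using xs by (auto simp: inj_on_def nth_eq_iff_index_eq)
    ultimately have "degree_in M t = card ?P"
      using degree_in_right[OF assms(1) ME t] by (simp add: card_image)
    moreover have "card ?P * d \<le> card S"
      using M t assms(3) xs(3)
      by (intro card_separated_positions) (auto simp: cyclic_distance_b_matching_def)
    ultimately show ?thesis
      using assms(2) by (simp add: less_eq_div_iff_mult_less_eq)
  qed
  then show ?thesis
    using bm by (auto simp: b_matching_def truncated_bound_def)
qed

lemma finite_cyclic_distance_b_matchings:
  "finite E \<Longrightarrow> finite {M. cyclic_distance_b_matching S T E d b xs M}"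
  by (rule finite_subset[of _ "Pow E"]) (auto simp: cyclic_distance_b_matching_def b_matching_def)

lemma opt_weight_le:
  assumes "valid_instance S T E w d" "max_weight_b_matching S T E w (truncated_bound S T d b) Mhat"
  shows "opt_weight S T E w d b \<le> weight w Mhat"
proof -
  have G: "bipartite_graph S T E" "1 \<le> d" "d \<le> card S"
    using assms by (auto simp: valid_instance_def)
  then have fin: "finite S" "finite E"
    using finite_subset by (auto simp: bipartite_graph_def)
  have "heaviest_weight S T E w d b xs \<le> weight w Mhat" if xs: "xs \<in> permutations_of_set S" for xs
  proof -
    \<comment> \<open>The empty matching guarantees that the maximum is taken over a nonempty
      set.\<close>
    have "cyclic_distance_b_matching S T E d b xs {}"
      by (simp add: cyclic_distance_b_matching_def b_matching_def degree_in_def zero_enat_def[symmetric])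
    then have "{M. cyclic_distance_b_matching S T E d b xs M} \<noteq> {}" by blast
    moreover have "weight w M \<le> weight w Mhat" if "cyclic_distance_b_matching S T E d b xs M" for M
      using cyclic_distance_imp_truncated[OF G xs that] assms(2)
      by (auto simp: max_weight_b_matching_def)
    ultimately show ?thesis
      unfolding heaviest_weight_def using finite_cyclic_distance_b_matchings[OF fin(2)]
      by (subst Max_le_iff) auto
  qed
  then show ?thesis
    unfolding opt_weight_def using fin by (subst Max_le_iff) auto
qed

lemma opt_weight_ge:
  assumes "finite S" "finite E" "xs \<in> permutations_of_set S"
    and "cyclic_distance_b_matching S T E d b xs M"
  shows "weight w M \<le> opt_weight S T E w d b"
proof -
  have "weight w M \<le> heaviest_weight S T E w d b xs"
    unfolding heaviest_weight_def
    using finite_cyclic_distance_b_matchings[OF assms(2)] assms(4) by (intro Max_ge) auto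
  also have "\<dots> \<le> opt_weight S T E w d b"
    unfolding opt_weight_def using assms by (intro Max_ge) auto
  finally show ?thesis .
qed

section \<open>The approximation guarantee\<close>

lemma expectation_algorithm_output_ge:
  assumes "valid_instance S T E w d" "max_weight_b_matching S T E w (truncated_bound S T d b) Mhat"
  shows "measure_pmf.expectation (algorithm_output S d Mhat) (\<lambda>(xs, M). weight w M)
           \<ge> 1 / exp 1 * opt_weight S T E w d b"
proof -
  have G: "bipartite_graph S T E" "1 \<le> d" "d \<le> card S" and w: "\<And>e. e \<in> E \<Longrightarrow> 0 \<le> w e"
    using assms by (auto simp: valid_instance_def)
  have bm: "b_matching S T E (truncated_bound S T d b) Mhat" and ME: "Mhat \<subseteq> E"
    using assms by (auto simp: max_weight_b_matching_def b_matching_def)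
  have fin: "finite S"
    using G by (auto simp: bipartite_graph_def)
  have "1 / exp 1 * opt_weight S T E w d b \<le> 1 / exp 1 * weight w Mhat"
    by (intro mult_left_mono opt_weight_le[OF assms]) auto
  also have "\<dots> = (\<Sum>(s, t)\<in>Mhat. w (s, t) * (1 / exp 1))"
    by (simp add: weight_def sum_divide_distrib case_prod_unfold)
  also have "\<dots> \<le> (\<Sum>(s, t)\<in>Mhat. w (s, t) * isolation_prob (card S) d (degree_in Mhat t))"
  proof (rule sum_mono, clarify)
    fix s t assume st: "(s, t) \<in> Mhat"
    have t: "t \<in> T" using st ME G by (auto simp: bipartite_graph_def)
    have "{s. (s, t) \<in> Mhat} \<subseteq> S" using ME G by (auto simp: bipartite_graph_def)
    then have "finite {s. (s, t) \<in> Mhat}" using fin finite_subset by blast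
    \<comment> \<open>The two hypotheses of \<open>isolation_prob_ge\<close> come from the edge
      itself, which makes the degree positive, and from the truncated bound, which gives degree
      times \<open>d\<close> at most \<open>card S\<close>.\<close>
    then have "1 \<le> degree_in Mhat t"
      using st unfolding degree_in_right[OF G(1) ME t] by (auto simp: Suc_le_eq card_gt_0_iff)
    moreover have "enat (degree_in Mhat t) \<le> truncated_bound S T d b t"
      using bm t by (auto simp: b_matching_def)
    then have "degree_in Mhat t \<le> card S div d"
      using t by (simp add: truncated_bound_def)
    then have "degree_in Mhat t * d \<le> card S"
      using G by (simp add: less_eq_div_iff_mult_less_eq)
    ultimately have "1 / exp 1 \<le> isolation_prob (card S) d (degree_in Mhat t)"
      using G by (intro isolation_prob_ge)
    then show "w (s, t) * (1 / exp 1) \<le> w (s, t) * isolation_prob (card S) d (degree_in Mhat t)"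
      using w st ME by (intro mult_left_mono) auto
  qed
  also have "\<dots> = measure_pmf.expectation (algorithm_output S d Mhat) (\<lambda>(xs, M). weight w M)"
    using expectation_algorithm_output[OF G ME] by simp
  finally show ?thesis .
qed

section \<open>Tightness on stars\<close>

lemma star_instance_expectation:
  fixes m :: nat
  assumes m: "2 \<le> m"
  defines "S \<equiv> {..<m * m}" and "T \<equiv> {m * m}" and "E \<equiv> {..<m * m} \<times> {m * m}"
    and "w \<equiv> (\<lambda>_. 1)" and "b \<equiv> (\<lambda>_. \<infinity>)"
  shows "valid_instance S T E w m"
    and "\<exists>Mhat. max_weight_b_matching S T E w (truncated_bound S T m b) Mhat"
    and "real m \<le> opt_weight S T E w m b"
    and "max_weight_b_matching S T E w (truncated_bound S T m b) Mhat \<Longrightarrow>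
      measure_pmf.expectation (algorithm_output S m Mhat) (\<lambda>(xs, M). weight w M)
        \<le> real m * exp (- (((real m - 1) / real m)\<^sup>2))"
proof -
  let ?t = "m * m"
  let ?b = "truncated_bound S T m b"
  have G: "bipartite_graph S T E"
    by (auto simp: bipartite_graph_def S_def T_def E_def)
  have fin: "finite S" "finite E" and n: "card S = m * m"
    by (auto simp: S_def E_def)
  show inst: "valid_instance S T E w m"
    using m G by (auto simp: valid_instance_def S_def w_def)
  have deg: "degree_in M ?t = card M" if "M \<subseteq> E" for M
  proof -
    have "{e \<in> M. fst e = ?t \<or> snd e = ?t} = M" using that by (auto simp: E_def)
    then show ?thesis by (simp add: degree_in_def)
  qed
  \<comment> \<open>Since \<open>b\<close> is infinite, only the truncation at the centre
    constrains, and \<open>m * m div m = m\<close>. With unit weights, the maximum-weight matchings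
    are therefore exactly the sets of \<open>m\<close> edges.\<close>
  have bm: "b_matching S T E ?b M \<longleftrightarrow> M \<subseteq> E \<and> card M \<le> m" for M
  proof -
    have "S \<inter> T = {}" by (auto simp: S_def T_def)
    then have "(\<forall>v\<in>S \<union> T. enat (degree_in M v) \<le> ?b v) \<longleftrightarrow> degree_in M ?t \<le> m"
      using m by (auto simp: truncated_bound_def b_def n T_def)
    then show ?thesis using deg by (auto simp: b_matching_def)
  qed
  have weight: "weight w M = real (card M)" for M
    by (simp add: weight_def w_def)

  \<comment> \<open>Every \<open>m\<close>-th leaf is used. Under the natural order two such leaves
    are at least \<open>m\<close> and at most \<open>(m - 1) * m = n - m\<close> apart, so
    \<open>M0\<close> is both a truncated matching and feasible for distance
    \<open>m\<close>.\<close>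
  define M0 where "M0 = (\<lambda>i. (i * m, ?t)) ` {..<m}"
  have M0: "M0 \<subseteq> E" "card M0 = m"
    using m by (auto simp: M0_def E_def card_image inj_on_def)
  have "max_weight_b_matching S T E w ?b M0"
    using M0 by (auto simp: max_weight_b_matching_def bm weight)
  then show "\<exists>Mhat. max_weight_b_matching S T E w ?b Mhat" by blast
  have xs: "[0..<m * m] \<in> permutations_of_set S"
    by (auto simp: permutations_of_set_def S_def)
  have sep: "int m \<le> \<bar>int (i * m) - int (j * m)\<bar> \<and>
      \<bar>int (i * m) - int (j * m)\<bar> \<le> int (m * m) - int m"
    if "i < m" "j < m" "i \<noteq> j" for i j
  proof -
    have "\<bar>int (i * m) - int (j * m)\<bar> = \<bar>int i - int j\<bar> * int m"
      by (simp add: abs_mult flip: left_diff_distrib)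
    moreover have "1 * int m \<le> \<bar>int i - int j\<bar> * int m"
      using that by (intro mult_right_mono) auto
    moreover have "\<bar>int i - int j\<bar> * int m \<le> (int m - 1) * int m"
      using that by (intro mult_right_mono) auto
    ultimately show ?thesis by (simp add: algebra_simps)
  qed
  have "cyclic_distance_b_matching S T E m b [0..<m * m] M0"
    unfolding cyclic_distance_b_matching_def
  proof (intro conjI allI ballI impI; (elim conjE)?)
    show "b_matching S T E b M0"
      using M0 by (auto simp: b_matching_def b_def)
  next
    fix i j t
    assume ij: "i < length [0..<m * m]" "j < length [0..<m * m]" "i \<noteq> j"
      "([0..<m * m] ! i, t) \<in> M0" "([0..<m * m] ! j, t) \<in> M0"
    then obtain i' j' where "i = i' * m" "j = j' * m" "i' < m" "j' < m"
      by (auto simp: M0_def)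
    with sep[of i' j'] ij
    show "int m \<le> \<bar>int i - int j\<bar>" "\<bar>int i - int j\<bar> \<le> int (length [0..<m * m]) - int m"
      by auto
  qed
  then show "real m \<le> opt_weight S T E w m b"
    using opt_weight_ge[OF fin xs, of T m b M0 w] M0 by (simp add: weight)

  assume Mhat: "max_weight_b_matching S T E w ?b Mhat"
  \<comment> \<open>Comparison with \<open>M0\<close> forces exactly \<open>m\<close> edges, so the
    estimate holds for whichever maximum-weight matching is found.\<close>
  have ME: "Mhat \<subseteq> E" and "card Mhat \<le> m" and "card M0 \<le> card Mhat"
    using Mhat M0 bm weight by (auto simp: max_weight_b_matching_def)
  then have card: "card Mhat = m" using M0 by simp
  have "measure_pmf.expectation (algorithm_output S m Mhat) (\<lambda>(xs, M). weight w M) =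
      (\<Sum>(s, t)\<in>Mhat. w (s, t) * isolation_prob (card S) m (degree_in Mhat t))"
    using m n by (intro expectation_algorithm_output[OF G _ _ ME]) auto
  also have "\<dots> = (\<Sum>(s, t)\<in>Mhat. isolation_prob (m * m) m m)"
    using ME deg[OF ME] by (intro sum.cong refl) (auto simp: w_def n card E_def)
  also have "\<dots> = real m * isolation_prob (m * m) m m"
    by (simp add: case_prod_unfold card)
  also have "\<dots> \<le> real m * exp (- ((real m - 1) * (real m - 1) / real (m * m)))"
  proof (intro mult_left_mono isolation_prob_le)
    have "2 * m \<le> m * m" using m by (intro mult_right_mono) auto
    then show "m + m \<le> m * m + 1" by linarith
  qed (use m in auto)
  also have "(real m - 1) * (real m - 1) / real (m * m) = ((real m - 1) / real m)\<^sup>2"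
    by (simp add: power2_eq_square)
  finally show "measure_pmf.expectation (algorithm_output S m Mhat) (\<lambda>(xs, M). weight w M)
        \<le> real m * exp (- (((real m - 1) / real m)\<^sup>2))" .
qed

theorem theorem12:
  shows "(\<forall>(S :: 'v set) T E w d b Mhat.
            valid_instance S T E w d \<and>
            max_weight_b_matching S T E w (truncated_bound S T d b) Mhat \<longrightarrow>
              (\<forall>(xs, M) \<in> set_pmf (algorithm_output S d Mhat).
                 xs \<in> permutations_of_set S \<and> cyclic_distance_b_matching S T E d b xs M) \<and>
              measure_pmf.expectation (algorithm_output S d Mhat) (\<lambda>(xs, M). weight w M)
                \<ge> 1 / exp 1 * opt_weight S T E w d b) \<and>
         (\<forall>c > 1 / exp 1.
            \<exists>(S :: nat set) T E w d b.
              valid_instance S T E w d \<and>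
              (\<exists>Mhat. max_weight_b_matching S T E w (truncated_bound S T d b) Mhat) \<and>
              (\<forall>Mhat. max_weight_b_matching S T E w (truncated_bound S T d b) Mhat \<longrightarrow>
                 measure_pmf.expectation (algorithm_output S d Mhat) (\<lambda>(xs, M). weight w M)
                   < c * opt_weight S T E w d b))"
proof (intro conjI allI impI; (elim conjE)?)
  fix S T :: "'v set" and E w d b Mhat
  assume inst: "valid_instance S T E w d"
    and Mhat: "max_weight_b_matching S T E w (truncated_bound S T d b) Mhat"
  show "measure_pmf.expectation (algorithm_output S d Mhat) (\<lambda>(xs, M). weight w M)
          \<ge> 1 / exp 1 * opt_weight S T E w d b"
    by (rule expectation_algorithm_output_ge[OF inst Mhat])
  have fin: "finite S" using inst by (auto simp: valid_instance_def bipartite_graph_def)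
  show "\<forall>(xs, M) \<in> set_pmf (algorithm_output S d Mhat).
          xs \<in> permutations_of_set S \<and> cyclic_distance_b_matching S T E d b xs M"
    using inst Mhat fin selected_edges_feasible[of S T E d b Mhat]
    by (auto simp: algorithm_output_def valid_instance_def max_weight_b_matching_def)
next
  fix c :: real assume c: "c > 1 / exp 1"
  \<comment> \<open>The survival bound of the star instances tends to 1/e, so it drops below any
    \<open>c > 1 / exp 1\<close> for large \<open>m\<close>.\<close>
  have "((\<lambda>m. exp (- (((real m - 1) / real m)\<^sup>2))) \<longlongrightarrow> exp (- (1\<^sup>2))) sequentially"
  proof (intro tendsto_intros)
    have "eventually (\<lambda>m. 1 - 1 / real m = (real m - 1) / real m) sequentially"
      using eventually_gt_at_top[of 0] by eventually_elim (simp add: field_simps)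
    moreover have "(\<lambda>m. 1 - 1 / real m) \<longlonglongrightarrow> 1 - 0"
      by (intro tendsto_intros lim_1_over_n)
    ultimately show "(\<lambda>m. (real m - 1) / real m) \<longlonglongrightarrow> 1"
      using Lim_transform_eventually by fastforce
  qed
  moreover have "exp (- (1\<^sup>2)) < c" using c by (simp add: exp_minus field_simps)
  ultimately have "eventually (\<lambda>m. exp (- (((real m - 1) / real m)\<^sup>2)) < c) sequentially"
    using order_tendstoD(2) by blast
  then have "eventually (\<lambda>m. exp (- (((real m - 1) / real m)\<^sup>2)) < c \<and> 2 \<le> m) sequentially"
    using eventually_ge_at_top[of 2] by (rule eventually_conj)
  then obtain m :: nat where m: "exp (- (((real m - 1) / real m)\<^sup>2)) < c" "2 \<le> m"
    using eventually_happens'[OF sequentially_bot] by blast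
  let ?S = "{..<m * m}" and ?T = "{m * m}" and ?E = "{..<m * m} \<times> {m * m}"
    and ?w = "\<lambda>_ :: nat \<times> nat. 1 :: real" and ?b = "\<lambda>_ :: nat. \<infinity> :: enat"
  note star = star_instance_expectation[OF m(2)]
  have less: "measure_pmf.expectation (algorithm_output ?S m Mhat) (\<lambda>(xs, M). weight ?w M)
      < c * opt_weight ?S ?T ?E ?w m ?b"
    if "max_weight_b_matching ?S ?T ?E ?w (truncated_bound ?S ?T m ?b) Mhat" for Mhat
  proof -
    have "measure_pmf.expectation (algorithm_output ?S m Mhat) (\<lambda>(xs, M). weight ?w M)
        \<le> real m * exp (- (((real m - 1) / real m)\<^sup>2))"
      using star(4)[OF that] .
    also have "\<dots> < real m * c"
      using m by (intro mult_strict_left_mono) auto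
    also have "\<dots> = c * real m" by simp
    \<comment> \<open>Only the lower bound \<open>m\<close> on the optimum is known, so
      \<open>c\<close> must be nonnegative here.\<close>
    also have "\<dots> \<le> c * opt_weight ?S ?T ?E ?w m ?b"
    proof (intro mult_left_mono star(3))
      have "0 \<le> 1 / exp (1 :: real)" by simp
      then show "0 \<le> c" using c by linarith
    qed
    finally show ?thesis .
  qed
  show "\<exists>(S :: nat set) T E w d b.
      valid_instance S T E w d \<and>
      (\<exists>Mhat. max_weight_b_matching S T E w (truncated_bound S T d b) Mhat) \<and>
      (\<forall>Mhat. max_weight_b_matching S T E w (truncated_bound S T d b) Mhat \<longrightarrow>
         measure_pmf.expectation (algorithm_output S d Mhat) (\<lambda>(xs, M). weight w M)
           < c * opt_weight S T E w d b)"
    by (rule exI[of _ ?S], rule exI[of _ ?T], rule exI[of _ ?E], rule exI[of _ ?w],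
        rule exI[of _ m], rule exI[of _ ?b])
       (intro conjI allI impI star(1,2) less)
qed

end
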